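(* Let $\mathrm{P}=(p_n(x))_{n\ge0}$ be a family of monic polynomials with associated power series $(f_n(y))_{n\ge0}$, operators $\mathrm{G_P},\mathrm{U_P},\mathrm{D_P}$ and associated family $\widetilde{\mathrm P}=(\widetilde p_n)_{n\ge 0}$ with series $(\widetilde f_n)_{n\ge 0}$. Then, as linear operators on $\mathbb{C}[x]$, $$\mathrm{D_P}=\frac{f_{\mathrm{U_PD_P}+1}}{f_{\mathrm{U_PD_P}}}(\mathrm{D}),\qquad \mathrm{U_P}=f_0(\mathrm{D})^{-1}\,x\,\mathrm{G}_{\widetilde{\mathrm P}}\,\mathrm{G}_{\mathrm P}^{-1},$$ and consequently $$x=f_0(\mathrm{D})\,\mathrm{U_P}\,\frac{\widetilde f_{\mathrm{U_PD_P}}}{f_{\mathrm{U_PD_P}}}(\mathrm{D}),$$ where $x$ denotes the operator of multiplication by $x$.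
   Context: A family of monic polynomials is a sequence $\mathrm P=(p_n(x))_{n\ge0}$ in $\mathbb{C}[x]$ with $\deg p_n=n$ and leading coefficient $1$. $\mathrm{D}=\frac{d}{dx}$. $\mathrm{G_P}$ is the invertible linear operator on $\mathbb{C}[x]$ with $\mathrm{G_P}\cdot x^n=p_n(x)$; $\mathrm{U_P}=\mathrm{G_P}x\mathrm{G}_{\mathrm P}^{-1}$ and $\mathrm{D_P}=\mathrm{G_P}\mathrm{D}\mathrm{G}_{\mathrm P}^{-1}$, so $\mathrm{U_P}p_n=p_{n+1}$ and $\mathrm{D_P}p_n=np_{n-1}$. For a sequence $(a_n)_{n\ge0}$ of complex numbers, $a_{\mathrm{U_PD_P}}$ denotes the linear operator with $a_{\mathrm{U_PD_P}}\cdot p_n=a_np_n$. The series $f_n(y)\in y^n+y^{n+1}\mathbb{C}[[y]]$ are the unique ones with $e^{xy}=\sum_{n\ge0}\frac{p_n(x)f_n(y)}{n!}$. For a sequence of power series $h_n(y)=\sum_{k\ge0}c_k^{n}y^k$, the symbol $h_{\mathrm{U_PD_P}}(\mathrm{D})$ denotes the operator $\sum_{k\ge0}c_k^{\mathrm{U_PD_P}}\mathrm{D}^k$ on $\mathbb{C}[x]$ (coefficient operators to the left of powers of $\mathrm{D}$; only finitely many terms act nontrivially on a given polynomial), where $c_k^{\mathrm{U_PD_P}}\cdot p_n=c_k^np_n$. Thus $\frac{f_{\mathrm{U_PD_P}+1}}{f_{\mathrm{U_PD_P}}}(\mathrm{D})$ corresponds to $h_n(y)=f_{n+1}(y)/f_n(y)$,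 and $\frac{\widetilde f_{\mathrm{U_PD_P}}}{f_{\mathrm{U_PD_P}}}(\mathrm{D})$ to $h_n(y)=\widetilde f_n(y)/f_n(y)$. For a power series $g$, $g(\mathrm{D})$ is the usual operator obtained by substituting $\mathrm{D}$ for $y$; $f_0(\mathrm{D})$ is invertible since $f_0(0)=1$. The family $\widetilde{\mathrm P}$ is $\widetilde p_n(x)=\frac{f_0(\mathrm{D})\cdot p_{n+1}(x)}{x}$, $n\ge0$; it is a family of monic polynomials (the polynomial $f_0(\mathrm{D})\cdot p_{n+1}(x)$ vanishes at $x=0$), and its associated power series, determined by $e^{xy}=\sum_{n\ge0}\frac{\widetilde p_n(x)\widetilde f_n(y)}{n!}$, are $\widetilde f_n(y)=\frac{1}{n+1}\left(\frac{f_{n+1}(y)}{f_0(y)}\right)'$. $\mathrm{G}_{\widetilde{\mathrm P}}$ is the operator $x^n\mapsto\widetilde p_n(x)$. *)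

theory Defs
  imports "HOL-Computational_Algebra.Computational_Algebra"
begin

definition monic_family :: "(nat \<Rightarrow> complex poly) \<Rightarrow> bool" where
  "monic_family p \<longleftrightarrow> (\<forall>n. degree (p n) = n \<and> lead_coeff (p n) = 1)"

definition mult_x :: "complex poly \<Rightarrow> complex poly" where
  "mult_x q = [:0, 1:] * q"

text \<open>The linear operator with \<open>x ^ n \<mapsto> p n\<close>.\<close>

definition G_op :: "(nat \<Rightarrow> complex poly) \<Rightarrow> complex poly \<Rightarrow> complex poly" where
  "G_op p q = (\<Sum>n\<le>degree q. smult (coeff q n) (p n))"

definition U_op :: "(nat \<Rightarrow> complex poly) \<Rightarrow> complex poly \<Rightarrow> complex poly" where
  "U_op p = G_op p \<circ> mult_x \<circ> inv (G_op p)"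

definition D_op :: "(nat \<Rightarrow> complex poly) \<Rightarrow> complex poly \<Rightarrow> complex poly" where
  "D_op p = G_op p \<circ> pderiv \<circ> inv (G_op p)"

text \<open>The operator \<open>a\<^bsub>U D\<^esub>\<close> with \<open>p n \<mapsto> a n * p n\<close>, obtained by composing
  \<open>x ^ n \<mapsto> a n * p n\<close> with the inverse of \<open>x ^ n \<mapsto> p n\<close>.\<close>

definition diag_op ::
    "(nat \<Rightarrow> complex poly) \<Rightarrow> (nat \<Rightarrow> complex) \<Rightarrow> complex poly \<Rightarrow> complex poly" where
  "diag_op p a = G_op (\<lambda>n. smult (a n) (p n)) \<circ> inv (G_op p)"

text \<open>In the next two definitions the sums stop at \<open>degree q\<close>
  because higher derivatives of \<open>q\<close> vanish.\<close>

definition fps_D :: "complex fps \<Rightarrow> complex poly \<Rightarrow> complex poly" where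
  "fps_D g q = (\<Sum>k\<le>degree q. smult (fps_nth g k) ((pderiv ^^ k) q))"

definition fps_UD_D ::
    "(nat \<Rightarrow> complex poly) \<Rightarrow> (nat \<Rightarrow> complex fps) \<Rightarrow> complex poly \<Rightarrow> complex poly" where
  "fps_UD_D p h q = (\<Sum>k\<le>degree q. diag_op p (\<lambda>n. fps_nth (h n) k) ((pderiv ^^ k) q))"

text \<open>Identities between formal series in \<open>x\<close> and \<open>y\<close> are read in \<open>\<complex>[x][[y]]\<close>, with
  convergence in the metric of formal power series. The right-hand side of \<open>sums\<close> is
  \<open>exp (x * y)\<close>; the general term is \<open>p n (x) * f n (y) / n!\<close>.\<close>

definition is_assoc_series :: "(nat \<Rightarrow> complex poly) \<Rightarrow> (nat \<Rightarrow> complex fps) \<Rightarrow> bool" where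
  "is_assoc_series p f \<longleftrightarrow>
     (\<forall>n. fps_nth (f n) n = 1 \<and> (\<forall>k<n. fps_nth (f n) k = 0)) \<and>
     (\<lambda>n. Abs_fps (\<lambda>k. smult (fps_nth (f n) k / fact n) (p n)))
       sums Abs_fps (\<lambda>k. monom (1 / fact k) k)"

definition assoc_series :: "(nat \<Rightarrow> complex poly) \<Rightarrow> nat \<Rightarrow> complex fps" where
  "assoc_series p = (THE f. is_assoc_series p f)"

text \<open>The division by \<open>x\<close> is exact for a monic family.\<close>

definition tilde_family :: "(nat \<Rightarrow> complex poly) \<Rightarrow> nat \<Rightarrow> complex poly" where
  "tilde_family p n = fps_D (assoc_series p 0) (p (n + 1)) div [:0, 1:]"


text \<open>Existence and uniqueness of the associated series, so that \<open>assoc_series\<close> is well defined.\<close>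

lemma G_op_upto: "degree q \<le> N \<Longrightarrow> G_op p q = (\<Sum>n\<le>N. smult (coeff q n) (p n))"
  unfolding G_op_def by (rule sum.mono_neutral_left) (auto simp: coeff_eq_0)

lemma G_op_diff: "G_op p (q - r) = G_op p q - G_op p r"
proof -
  let ?N = "max (degree q) (degree r)"
  have "degree (q - r) \<le> ?N" by (rule degree_diff_le_max)
  then show ?thesis
    by (simp add: G_op_upto[of _ ?N] sum_subtractf smult_diff_left)
qed

lemma smult_sum: "smult c (\<Sum>i\<in>S. f i) = (\<Sum>i\<in>S. smult c (f i))"
  by (induction S rule: infinite_finite_induct) (auto simp: smult_add_right)

lemma coeff_G_op_degree:
  assumes "monic_family p"
  shows "coeff (G_op p q) (degree q) = lead_coeff q"
proof -
  have "coeff (G_op p q) (degree q) = (\<Sum>n\<le>degree q. coeff q n * coeff (p n) (degree q))"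
    by (simp add: G_op_def coeff_sum)
  also have "\<dots> = (\<Sum>n\<in>{degree q}. coeff q n * coeff (p n) (degree q))"
    using assms by (intro sum.mono_neutral_right) (auto simp: monic_family_def coeff_eq_0)
  also have "\<dots> = lead_coeff q"
    using assms by (simp add: monic_family_def) (metis mult.right_neutral)
  finally show ?thesis .
qed

lemma degree_G_op:
  assumes "monic_family p"
  shows "degree (G_op p q) = degree q"
proof (rule antisym)
  show "degree (G_op p q) \<le> degree q"
    unfolding G_op_def
    by (rule degree_sum_le) (use assms in \<open>auto simp: monic_family_def intro: order_trans[OF degree_smult_le]\<close>)
  show "degree q \<le> degree (G_op p q)"
    using coeff_G_op_degree[OF assms, of q]
    by (metis le_degree leading_coeff_0_iff degree_0 le0)
qed

lemma bij_G_op: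
  assumes "monic_family p"
  shows "bij (G_op p)"
proof (rule bijI)
  show "inj (G_op p)"
  proof (rule injI)
    fix q r assume "G_op p q = G_op p r"
    then have "G_op p (q - r) = 0" by (simp add: G_op_diff)
    then have "lead_coeff (q - r) = 0" using coeff_G_op_degree[OF assms, of "q - r"] by simp
    then show "q = r" by (simp only: leading_coeff_0_iff) simp
  qed
  have "\<exists>r. G_op p r = q" if "degree q < N" for q N
    using that
  proof (induction N arbitrary: q)
    case (Suc N)
    define s where "s = monom (coeff q N) N"
    have deg: "degree s \<le> N" unfolding s_def by (rule degree_monom_le)
    have Gs: "G_op p s = smult (coeff q N) (p N)"
    proof -
      have "G_op p s = (\<Sum>n\<in>{N}. smult (coeff s n) (p n))"
        unfolding G_op_upto[OF deg] by (rule sum.mono_neutral_right) (auto simp: s_def)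
      then show ?thesis by (simp add: s_def)
    qed
    define t where "t = q - G_op p s"
    have 1: "degree t \<le> N" unfolding t_def
      using Suc.prems deg degree_G_op[OF assms, of s] by (intro degree_diff_le) auto
    have 2: "coeff t N = 0" unfolding t_def Gs
      using assms by (simp add: monic_family_def) (metis mult.right_neutral)
    have "\<exists>r. G_op p r = t"
    proof (cases "t = 0")
      case True then show ?thesis by (intro exI[of _ 0]) (simp add: G_op_def)
    next
      case False
      then have "degree t \<noteq> N" using 2 by (metis leading_coeff_0_iff)
      with 1 show ?thesis by (intro Suc.IH) simp
    qed
    then obtain r where "G_op p r = t" by blast
    moreover have "G_op p 0 = 0" by (simp add: G_op_def)
    ultimately have "G_op p (s - (0 - r)) = q"
      by (simp only: G_op_diff t_def) simp
    then show ?case by blast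
  qed simp
  then show "surj (G_op p)" by (metis lessI surjI surj_def)
qed

lemma is_assoc_series_iff:
  "is_assoc_series p f \<longleftrightarrow>
     (\<forall>n. fps_nth (f n) n = 1 \<and> (\<forall>k<n. fps_nth (f n) k = 0)) \<and>
     (\<forall>k. (\<Sum>n\<le>k. smult (fps_nth (f n) k / fact n) (p n)) = monom (1 / fact k) k)"
proof (cases "\<forall>n. \<forall>k<n. fps_nth (f n) k = 0")
  case True
  have nth: "fps_nth (\<Sum>n<N. Abs_fps (\<lambda>k. smult (fps_nth (f n) k / fact n) (p n))) k
      = (\<Sum>n\<le>k. smult (fps_nth (f n) k / fact n) (p n))" if "N > k" for N k
    unfolding fps_sum_nth using True that
    by (intro sum.mono_neutral_cong_right) auto
  have "(\<forall>\<^sub>F N in sequentially.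
      fps_nth (\<Sum>n<N. Abs_fps (\<lambda>k. smult (fps_nth (f n) k / fact n) (p n))) k = c)
    \<longleftrightarrow> (\<Sum>n\<le>k. smult (fps_nth (f n) k / fact n) (p n)) = c" for k c
  proof -
    have "(\<forall>\<^sub>F N in sequentially.
      fps_nth (\<Sum>n<N. Abs_fps (\<lambda>k. smult (fps_nth (f n) k / fact n) (p n))) k = c) \<longleftrightarrow>
      (\<forall>\<^sub>F N in sequentially. (\<Sum>n\<le>k. smult (fps_nth (f n) k / fact n) (p n)) = c)"
      by (intro eventually_cong[OF eventually_gt_at_top[of k]]) (simp only: nth)
    then show ?thesis by simp
  qed
  then show ?thesis
    unfolding is_assoc_series_def sums_def tendsto_fps_iff by simp
qed (auto simp: is_assoc_series_def)

lemma ex1_assoc_series: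
  assumes "monic_family p"
  shows "\<exists>!f. is_assoc_series p f"
proof (rule ex_ex1I)
  define A where "A k = inv (G_op p) (monom 1 k)" for k
  have GA: "G_op p (A k) = monom 1 k" for k
    unfolding A_def using bij_G_op[OF assms] by (simp add: bij_is_surj surj_f_inv_f)
  have degA: "degree (A k) = k" for k
    using degree_G_op[OF assms, of "A k"] by (simp add: GA degree_monom_eq)
  have leadA: "coeff (A k) k = 1" for k
    using coeff_G_op_degree[OF assms, of "A k"] by (simp add: GA degA)
  define f where "f n = Abs_fps (\<lambda>k. fact n / fact k * coeff (A k) n)" for n
  have "(\<Sum>n\<le>k. smult (fps_nth (f n) k / fact n) (p n)) = monom (1 / fact k) k" for k
  proof -
    have "(\<Sum>n\<le>k. smult (fps_nth (f n) k / fact n) (p n)) = smult (1 / fact k) (G_op p (A k))"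
      by (simp add: G_op_def degA f_def smult_sum)
    then show ?thesis by (simp add: GA smult_monom)
  qed
  then have "is_assoc_series p f"
    unfolding is_assoc_series_iff by (simp add: f_def leadA coeff_eq_0 degA)
  then show "\<exists>f. is_assoc_series p f" by (rule exI[of _ f])
next
  fix f g assume fg: "is_assoc_series p f" "is_assoc_series p g"
  show "f = g"
  proof (intro ext fps_ext)
    fix n k
    have G: "G_op p (\<Sum>n\<le>k. monom (fps_nth (h n) k / fact n) n) = monom (1 / fact k) k"
      if "is_assoc_series p h" for h
    proof -
      have "degree (\<Sum>n\<le>k. monom (fps_nth (h n) k / fact n) n) \<le> k"
        by (rule degree_sum_le) (auto intro: order_trans[OF degree_monom_le])
      then show ?thesis using that
        by (simp add: G_op_upto[of _ k] coeff_sum is_assoc_series_iff)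
    qed
    have eq: "(\<Sum>n\<le>k. monom (fps_nth (f n) k / fact n) n) = (\<Sum>n\<le>k. monom (fps_nth (g n) k / fact n) n)"
      by (rule injD[OF bij_is_inj[OF bij_G_op[OF assms]]]) (simp only: G[OF fg(1)] G[OF fg(2)])
    show "fps_nth (f n) k = fps_nth (g n) k"
    proof (cases "n \<le> k")
      case True
      then show ?thesis using arg_cong[OF eq, of "\<lambda>q. coeff q n"] by (simp add: coeff_sum)
    next
      case False
      then show ?thesis using fg by (simp add: is_assoc_series_iff)
    qed
  qed
qed

end

theory Submission
  imports Defs
begin

text \<open>
  Write \<open>f n\<close> for the associated series of \<open>p\<close>. Reading off the coefficient of \<open>y ^ k\<close> in
  \<open>exp (x * y) = (\<Sum>n. p n (x) * f n (y) / n!)\<close> expands \<open>x ^ k\<close> in the basis \<open>p\<close>, and by linearity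
  the coordinate of an arbitrary polynomial \<open>q\<close> along \<open>p n\<close> is the constant term of
  \<open>f n (D) q / n!\<close>, a Taylor formula for the family \<open>p\<close> (\<open>coeff_inv_G_op\<close>).

  All three identities are comparisons of such coordinates. Since the coefficient operators
  in \<open>h\<^bsub>U D\<^esub>(D)\<close> stand to the left of the powers of \<open>D\<close>, this operator turns the coordinate
  functional given by \<open>f n\<close> into the one given by the product \<open>f n * h n\<close>
  (\<open>coeff_inv_G_op_fps_UD_D\<close>). So a quotient \<open>h n = g n / f n\<close> replaces \<open>f n\<close> by \<open>g n\<close>.
  With \<open>g n = f (n + 1)\<close> this is the effect of \<open>D_op p\<close>, which sends the coordinate
  \<open>n + 1\<close>, times \<open>n + 1\<close>, to the place \<open>n\<close>. If \<open>g\<close> is the associated series of another monic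
  family \<open>r\<close>, the result is the change of basis \<open>G_op p \<circ> inv (G_op r)\<close>
  (\<open>fps_UD_D_assoc_series_ratio\<close>).

  The defining relation \<open>x * tilde_family p n = f 0 (D) (p (n + 1))\<close> says that
  \<open>f 0 (D) \<circ> U_op p\<close> and \<open>mult_x \<circ> G_op (tilde_family p) \<circ> inv (G_op p)\<close> agree on every \<open>p n\<close>.
  Inverting \<open>f 0 (D)\<close> gives the formula for \<open>U_op p\<close>; composing with the change of basis
  from \<open>tilde_family p\<close> to \<open>p\<close> leaves multiplication by \<open>x\<close>.
\<close>

section \<open>Operators that are power series in the derivative\<close>

lemma higher_pderiv_eq_0:
  fixes q :: "complex poly"
  assumes "degree q < k"
  shows "(pderiv ^^ k) q = 0"
proof (rule poly_eqI)
  show "coeff ((pderiv ^^ k) q) n = coeff 0 n" for n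
    using assms by (simp add: coeff_higher_pderiv coeff_eq_0)
qed

lemma degree_higher_pderiv_le: "degree ((pderiv ^^ k) q) \<le> degree (q :: complex poly)"
  by (simp add: degree_higher_pderiv)

lemma fps_D_upto:
  "degree q \<le> N \<Longrightarrow> fps_D g q = (\<Sum>k\<le>N. smult (fps_nth g k) ((pderiv ^^ k) q))"
  unfolding fps_D_def by (rule sum.mono_neutral_left) (auto simp: higher_pderiv_eq_0)

lemma fps_D_0 [simp]: "fps_D g 0 = 0"
  by (simp add: fps_D_def)

lemma fps_D_add: "fps_D g (q + r) = fps_D g q + fps_D g r"
proof -
  let ?N = "max (degree q) (degree r)"
  have "degree (q + r) \<le> ?N" by (rule degree_add_le_max)
  then show ?thesis
    by (simp add: fps_D_upto[of _ ?N] higher_pderiv_add smult_add_right sum.distrib)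
qed

lemma fps_D_smult: "fps_D g (smult c q) = smult c (fps_D g q)"
  by (simp add: fps_D_upto[of _ "degree q"] higher_pderiv_smult smult_sum mult.commute)

lemma fps_D_sum: "fps_D g (\<Sum>i\<in>S. r i) = (\<Sum>i\<in>S. fps_D g (r i))"
  by (induction S rule: infinite_finite_induct) (auto simp: fps_D_add)

lemma fps_D_1 [simp]: "fps_D 1 q = q"
proof -
  have "fps_D 1 q = (\<Sum>k\<in>{0}. smult (fps_nth 1 k) ((pderiv ^^ k) q))"
    unfolding fps_D_def by (rule sum.mono_neutral_right) auto
  then show ?thesis by simp
qed

text \<open>Substituting \<open>D\<close> for \<open>y\<close> is a ring homomorphism: beyond the triangle
  \<open>i + j \<le> degree q\<close> of the Cauchy product all derivatives of \<open>q\<close> vanish.\<close>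

lemma fps_D_mult: "fps_D (g * h) q = fps_D g (fps_D h q)"
proof -
  let ?N = "degree q"
  let ?t = "\<lambda>i j. smult (fps_nth g i * fps_nth h j) ((pderiv ^^ (i + j)) q)"
  have "fps_D g (fps_D h q) = (\<Sum>j\<le>?N. fps_D g (smult (fps_nth h j) ((pderiv ^^ j) q)))"
    by (subst (2) fps_D_def) (rule fps_D_sum)
  also have "\<dots> = (\<Sum>j\<le>?N. \<Sum>i\<le>?N. ?t i j)"
    by (simp add: fps_D_smult fps_D_upto[of _ ?N, OF degree_higher_pderiv_le]
        smult_sum funpow_add mult.commute)
  also have "\<dots> = (\<Sum>i\<le>?N. \<Sum>j\<le>?N. ?t i j)" by (rule sum.swap)
  also have "\<dots> = (\<Sum>(i, j)\<in>{..?N} \<times> {..?N}. ?t i j)" by (rule sum.cartesian_product)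
  also have "\<dots> = (\<Sum>(i, j)\<in>{(i, j). i + j \<le> ?N}. ?t i j)"
    by (rule sum.mono_neutral_right) (auto intro!: higher_pderiv_eq_0)
  also have "\<dots> = (\<Sum>k\<le>?N. \<Sum>i\<le>k. ?t i (k - i))" by (rule sum.triangle_reindex_eq)
  also have "\<dots> = fps_D (g * h) q"
    unfolding fps_D_def by (simp add: fps_mult_nth atLeast0AtMost Polynomial.smult_sum)
  finally show ?thesis ..
qed

lemma bij_fps_D:
  assumes "fps_nth g 0 \<noteq> 0"
  shows "bij (fps_D g)"
proof (rule o_bij)
  have "inverse g * g = 1" using assms by (simp add: inverse_mult_eq_1)
  then show "fps_D (inverse g) \<circ> fps_D g = id" "fps_D g \<circ> fps_D (inverse g) = id"
    by (simp_all add: fun_eq_iff mult.commute flip: fps_D_mult)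
qed

lemma degree_fps_D_le: "degree (fps_D g q) \<le> degree q"
  unfolding fps_D_def
  by (rule degree_sum_le)
    (auto intro: order_trans[OF degree_smult_le] degree_higher_pderiv_le)

lemma coeff_fps_D_degree: "coeff (fps_D g q) (degree q) = fps_nth g 0 * lead_coeff q"
proof -
  have "coeff (fps_D g q) (degree q) =
      (\<Sum>k\<le>degree q. fps_nth g k * coeff ((pderiv ^^ k) q) (degree q))"
    by (simp add: fps_D_def coeff_sum)
  also have "\<dots> = (\<Sum>k\<in>{0}. fps_nth g k * coeff ((pderiv ^^ k) q) (degree q))"
    by (rule sum.mono_neutral_right) (auto simp: coeff_higher_pderiv coeff_eq_0)
  finally show ?thesis by simp
qed

lemma coeff_0_fps_D:
  "coeff (fps_D g q) 0 = (\<Sum>k\<le>degree q. fps_nth g k * fact k * coeff q k)"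
  by (simp add: fps_D_def coeff_sum coeff_higher_pderiv pochhammer_fact mult.assoc)

section \<open>Coordinates with respect to a monic family\<close>

lemma G_op_inv [simp]: "monic_family p \<Longrightarrow> G_op p (inv (G_op p) q) = q"
  by (simp add: bij_G_op bij_is_surj surj_f_inv_f)

lemma inv_G_op [simp]: "monic_family p \<Longrightarrow> inv (G_op p) (G_op p q) = q"
  by (simp add: bij_G_op bij_is_inj)

lemma is_assoc_series_assoc_series: "monic_family p \<Longrightarrow> is_assoc_series p (assoc_series p)"
  unfolding assoc_series_def by (rule theI'[OF ex1_assoc_series])

lemma fps_nth_assoc_series:
  assumes "monic_family p"
  shows "fps_nth (assoc_series p n) n = 1" "k < n \<Longrightarrow> fps_nth (assoc_series p n) k = 0"
  using is_assoc_series_assoc_series[OF assms] by (auto simp: is_assoc_series_iff)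

text \<open>The Taylor formula for \<open>p\<close>. On \<open>x ^ k\<close> it is the coefficient of \<open>y ^ k\<close> in the expansion of
  \<open>exp (x * y)\<close>, because the constant term of \<open>f n (D) x ^ k\<close> is \<open>k!\<close> times the coefficient of
  \<open>y ^ k\<close> in \<open>f n\<close>. The proof checks that the polynomial \<open>r\<close> with the proposed
  coordinates is mapped to \<open>q\<close>.\<close>

lemma coeff_inv_G_op:
  assumes "monic_family p"
  shows "coeff (inv (G_op p) q) n = coeff (fps_D (assoc_series p n) q) 0 / fact n"
proof -
  let ?f = "assoc_series p" and ?d = "degree q"
  define a where "a n = coeff (fps_D (?f n) q) 0 / fact n" for n
  have a_gt: "a n = 0" if "n > ?d" for n
    using that by (simp add: a_def coeff_0_fps_D fps_nth_assoc_series[OF assms])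
  define r where "r = (\<Sum>n\<le>?d. monom (a n) n)"
  have coeff_r: "coeff r n = a n" for n
    by (simp add: r_def coeff_sum a_gt)
  have "degree r \<le> ?d"
    by (rule degree_le) (simp add: coeff_r a_gt)
  then have "G_op p r = (\<Sum>n\<le>?d. smult (a n) (p n))"
    by (simp add: G_op_upto coeff_r)
  also have "\<dots> = (\<Sum>n\<le>?d. \<Sum>k\<le>?d. smult (fact k * coeff q k) (smult (fps_nth (?f n) k / fact n) (p n)))"
    by (simp add: a_def coeff_0_fps_D sum_divide_distrib Polynomial.smult_sum mult_ac)
  also have "\<dots> = (\<Sum>k\<le>?d. smult (fact k * coeff q k) (\<Sum>n\<le>?d. smult (fps_nth (?f n) k / fact n) (p n)))"
    unfolding smult_sum by (rule sum.swap)
  also have "\<dots> = (\<Sum>k\<le>?d. monom (coeff q k) k)"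
  proof (rule sum.cong)
    fix k assume "k \<in> {..?d}"
    then have "(\<Sum>n\<le>?d. smult (fps_nth (?f n) k / fact n) (p n)) =
        (\<Sum>n\<le>k. smult (fps_nth (?f n) k / fact n) (p n))"
      by (intro sum.mono_neutral_right) (auto simp: fps_nth_assoc_series[OF assms])
    also have "\<dots> = monom (1 / fact k) k"
      using is_assoc_series_assoc_series[OF assms] by (simp add: is_assoc_series_iff)
    finally show "smult (fact k * coeff q k) (\<Sum>n\<le>?d. smult (fps_nth (?f n) k / fact n) (p n)) =
        monom (coeff q k) k"
      by (simp add: smult_monom)
  qed simp
  also have "\<dots> = q" by (rule poly_as_sum_of_monoms)
  finally have "inv (G_op p) q = r" using inv_G_op[OF assms] by metis
  then show ?thesis by (simp add: coeff_r a_def)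
qed

lemma coeff_inv_G_op_sum:
  assumes "monic_family p"
  shows "coeff (inv (G_op p) (\<Sum>i\<in>S. r i)) n = (\<Sum>i\<in>S. coeff (inv (G_op p) (r i)) n)"
  by (simp add: coeff_inv_G_op[OF assms] fps_D_sum coeff_sum sum_divide_distrib)

lemma coeff_inv_G_op_diag_op:
  assumes "monic_family p"
  shows "coeff (inv (G_op p) (diag_op p a q)) n = a n * coeff (inv (G_op p) q) n"
proof -
  define s where "s = inv (G_op p) q"
  define r where "r = (\<Sum>n\<le>degree s. monom (a n * coeff s n) n)"
  have coeff_r: "coeff r n = a n * coeff s n" for n
    by (simp add: r_def coeff_sum coeff_eq_0)
  have "degree r \<le> degree s"
    by (rule degree_le) (simp add: coeff_r coeff_eq_0)
  then have "diag_op p a q = G_op p r"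
    by (simp add: diag_op_def G_op_upto G_op_def[of "\<lambda>n. smult (a n) (p n)"] coeff_r
        mult.commute flip: s_def)
  then show ?thesis using assms by (simp add: coeff_r s_def)
qed

text \<open>On the coordinate \<open>n\<close> the coefficient operators act as the scalars \<open>fps_nth (h n) k\<close>,
  which commute with \<open>f n (D)\<close>; collecting them gives \<open>f n (D) h n (D)\<close>.\<close>

lemma coeff_inv_G_op_fps_UD_D:
  assumes "monic_family p"
  shows "coeff (inv (G_op p) (fps_UD_D p h q)) n =
    coeff (fps_D (assoc_series p n * h n) q) 0 / fact n"
proof -
  let ?f = "assoc_series p n"
  have "coeff (inv (G_op p) (fps_UD_D p h q)) n =
      (\<Sum>k\<le>degree q. fps_nth (h n) k * (coeff (fps_D ?f ((pderiv ^^ k) q)) 0 / fact n))"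
    by (simp add: fps_UD_D_def coeff_inv_G_op_sum coeff_inv_G_op_diag_op assms
        coeff_inv_G_op[of p "(pderiv ^^ _) q"])
  also have "\<dots> = coeff (fps_D ?f (fps_D (h n) q)) 0 / fact n"
    by (subst (2) fps_D_def)
      (simp add: fps_D_sum fps_D_smult coeff_sum sum_divide_distrib)
  finally show ?thesis by (simp add: fps_D_mult)
qed

text \<open>Division of power series is exact only if the order of the divisor does not exceed that of the
  dividend; here \<open>f n\<close> has order exactly \<open>n\<close>, whence the condition on \<open>g n\<close>.\<close>

lemma coeff_inv_G_op_fps_UD_D_divide:
  assumes "monic_family p" and "\<And>k. k < n \<Longrightarrow> fps_nth (g n) k = 0"
  shows "coeff (inv (G_op p) (fps_UD_D p (\<lambda>n. g n / assoc_series p n) q)) n =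
    coeff (fps_D (g n) q) 0 / fact n"
proof -
  let ?f = "assoc_series p n"
  have "subdegree ?f = n"
    by (rule subdegreeI) (simp_all add: fps_nth_assoc_series[OF assms(1)])
  moreover have "?f \<noteq> 0"
    using fps_nth_assoc_series(1)[OF assms(1), of n] by auto
  ultimately have "?f dvd g n"
    using assms(2) by (cases "g n = 0") (auto simp: fps_dvd_iff intro: subdegree_geI)
  then show ?thesis using assms(1) by (simp add: coeff_inv_G_op_fps_UD_D)
qed

section \<open>The family \<open>tilde_family p\<close>\<close>

lemma inv_G_op_family:
  assumes "monic_family p"
  shows "inv (G_op p) (p n) = monom 1 n"
proof -
  have "G_op p (monom 1 n) = (\<Sum>k\<in>{n}. smult (coeff (monom 1 n) k) (p k))"
    unfolding G_op_def by (rule sum.mono_neutral_right) (auto simp: degree_monom_eq)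
  then have "G_op p (monom 1 n) = p n" by simp
  then show ?thesis using inv_G_op[OF assms] by metis
qed

text \<open>The division by \<open>x\<close> leaves no remainder: the constant term of \<open>f 0 (D) (p (n + 1))\<close> is
  the coordinate of \<open>p (n + 1)\<close> along \<open>p 0\<close>, which is zero.\<close>

lemma mult_x_tilde_family:
  assumes "monic_family p"
  shows "mult_x (tilde_family p n) = fps_D (assoc_series p 0) (p (Suc n))"
proof -
  have "coeff (fps_D (assoc_series p 0) (p (Suc n))) 0 = 0"
    using coeff_inv_G_op[OF assms, of "p (Suc n)" 0] by (simp add: inv_G_op_family assms)
  then have "[:0, 1:] dvd fps_D (assoc_series p 0) (p (Suc n))"
    using poly_eq_0_iff_dvd[of _ "0 :: complex"] by (simp add: poly_0_coeff_0)
  then have "[:0, 1:] * (fps_D (assoc_series p 0) (p (Suc n)) div [:0, 1:]) =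
      fps_D (assoc_series p 0) (p (Suc n))"
    by (rule dvd_mult_div_cancel)
  then show ?thesis by (simp only: mult_x_def tilde_family_def Suc_eq_plus1)
qed

lemma monic_family_tilde_family:
  assumes "monic_family p"
  shows "monic_family (tilde_family p)"
  unfolding monic_family_def
proof
  fix n
  let ?t = "tilde_family p n" and ?q = "fps_D (assoc_series p 0) (p (Suc n))"
  have p: "degree (p (Suc n)) = Suc n" "coeff (p (Suc n)) (Suc n) = 1"
    using assms unfolding monic_family_def by metis+
  have eq: "coeff ?t k = coeff ?q (Suc k)" for k
    by (simp add: mult_x_def flip: mult_x_tilde_family[OF assms])
  have "coeff ?t n = 1"
    using coeff_fps_D_degree[of "assoc_series p 0" "p (Suc n)"] fps_nth_assoc_series[OF assms]
    by (simp add: eq p)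
  moreover have "degree ?t \<le> n"
    using degree_fps_D_le[of "assoc_series p 0" "p (Suc n)"]
    by (intro degree_le) (simp add: eq p coeff_eq_0)
  ultimately show "degree ?t = n \<and> lead_coeff ?t = 1"
    by (metis le_antisym le_degree zero_neq_one)
qed

section \<open>The operator identities\<close>

lemma D_op_eq:
  assumes "monic_family p"
  shows "D_op p = fps_UD_D p (\<lambda>n. assoc_series p (n + 1) / assoc_series p n)"
proof
  fix q
  have "inv (G_op p) (D_op p q) =
      inv (G_op p) (fps_UD_D p (\<lambda>n. assoc_series p (n + 1) / assoc_series p n) q)"
  proof (rule poly_eqI)
    fix n
    have "coeff (inv (G_op p) (D_op p q)) n = of_nat (Suc n) * coeff (inv (G_op p) q) (Suc n)"
      using assms by (simp add: D_op_def coeff_pderiv)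
    also have "\<dots> = coeff (fps_D (assoc_series p (n + 1)) q) 0 / fact n"
      using assms by (simp add: coeff_inv_G_op field_simps del: of_nat_Suc)
    also have "\<dots> = coeff (inv (G_op p)
        (fps_UD_D p (\<lambda>n. assoc_series p (n + 1) / assoc_series p n) q)) n"
      by (rule coeff_inv_G_op_fps_UD_D_divide[symmetric])
        (simp_all add: assms fps_nth_assoc_series)
    finally show "coeff (inv (G_op p) (D_op p q)) n = \<dots>" .
  qed
  then show "D_op p q = fps_UD_D p (\<lambda>n. assoc_series p (n + 1) / assoc_series p n) q"
    using G_op_inv[OF assms] by metis
qed

lemma fps_UD_D_assoc_series_ratio:
  assumes "monic_family p" "monic_family r"
  shows "fps_UD_D p (\<lambda>n. assoc_series r n / assoc_series p n) = G_op p \<circ> inv (G_op r)"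
proof
  fix q
  have "inv (G_op p) (fps_UD_D p (\<lambda>n. assoc_series r n / assoc_series p n) q) = inv (G_op r) q"
    by (rule poly_eqI, subst coeff_inv_G_op_fps_UD_D_divide)
      (simp_all add: assms fps_nth_assoc_series coeff_inv_G_op)
  then show "fps_UD_D p (\<lambda>n. assoc_series r n / assoc_series p n) q = (G_op p \<circ> inv (G_op r)) q"
    using G_op_inv[OF assms(1)] by (metis comp_apply)
qed

lemma fps_D_U_op:
  assumes "monic_family p"
  shows "fps_D (assoc_series p 0) \<circ> U_op p = mult_x \<circ> G_op (tilde_family p) \<circ> inv (G_op p)"
proof
  fix q
  define s where "s = inv (G_op p) q"
  have "degree (mult_x s) \<le> Suc (degree s)"
    by (simp add: mult_x_def degree_pCons_le)
  then have "G_op p (mult_x s) = (\<Sum>n\<le>Suc (degree s). smult (coeff (mult_x s) n) (p n))"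
    by (rule G_op_upto)
  also have "\<dots> = (\<Sum>n\<le>degree s. smult (coeff s n) (p (Suc n)))"
    by (simp add: sum.atMost_Suc_shift mult_x_def del: sum.atMost_Suc)
  finally have "fps_D (assoc_series p 0) (U_op p q) =
      (\<Sum>n\<le>degree s. smult (coeff s n) (mult_x (tilde_family p n)))"
    by (simp add: U_op_def fps_D_sum fps_D_smult mult_x_tilde_family assms flip: s_def)
  also have "\<dots> = mult_x (G_op (tilde_family p) s)"
    by (simp add: G_op_def mult_x_def sum_distrib_left)
  finally show "(fps_D (assoc_series p 0) \<circ> U_op p) q =
      (mult_x \<circ> G_op (tilde_family p) \<circ> inv (G_op p)) q"
    by (simp add: s_def)
qed

theorem mainTheorem2:
  fixes p :: "nat \<Rightarrow> complex poly"
  assumes "monic_family p"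
  shows "D_op p = fps_UD_D p (\<lambda>n. assoc_series p (n + 1) / assoc_series p n) \<and>
         U_op p = inv (fps_D (assoc_series p 0)) \<circ> mult_x \<circ> G_op (tilde_family p) \<circ> inv (G_op p) \<and>
         mult_x = fps_D (assoc_series p 0) \<circ> U_op p \<circ>
           fps_UD_D p (\<lambda>n. assoc_series (tilde_family p) n / assoc_series p n)"
proof (intro conjI)
  have tilde: "monic_family (tilde_family p)" by (rule monic_family_tilde_family[OF assms])
  show "D_op p = fps_UD_D p (\<lambda>n. assoc_series p (n + 1) / assoc_series p n)"
    by (rule D_op_eq[OF assms])
  have "bij (fps_D (assoc_series p 0))"
    by (rule bij_fps_D) (simp add: fps_nth_assoc_series[OF assms])
  then have "U_op p = inv (fps_D (assoc_series p 0)) \<circ> (fps_D (assoc_series p 0) \<circ> U_op p)"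
    by (simp add: fun_eq_iff bij_is_inj)
  then show "U_op p =
      inv (fps_D (assoc_series p 0)) \<circ> mult_x \<circ> G_op (tilde_family p) \<circ> inv (G_op p)"
    by (simp add: fps_D_U_op[OF assms] comp_assoc)
  show "mult_x = fps_D (assoc_series p 0) \<circ> U_op p \<circ>
      fps_UD_D p (\<lambda>n. assoc_series (tilde_family p) n / assoc_series p n)"
    by (simp add: fps_D_U_op fps_UD_D_assoc_series_ratio assms tilde fun_eq_iff)
qed

end
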